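(* For every $\alpha > 2/e$, there is no family of truthful direct-revelation mechanisms (one for each number of rounds $T$) for the two-bidder game ($k=2$) that is $\alpha$-competitive against selling the business.
   Context: Multiple-bidder game: there are $k\ge 2$ bidders and $T$ rounds; in each round the seller has one divisible item. Bidder $i$ has value $v_{i,t}\in[0,1]$ for the round-$t$ item; the values are arbitrary (adversarial), unknown to the seller, and each bidder knows all of its own values. A type profile is $\mathbf v=(v_{i,t})_{i\in[k],t\in[T]}$; write $|\mathbf v_i|=\sum_{t=1}^T v_{i,t}$. A direct-revelation mechanism specifies, for every profile $\mathbf v$, allocation fractions $r_{\mathbf v,i,t}\in[0,1]$ with $\sum_i r_{\mathbf v,i,t}\le 1$, prices $x_{\mathbf v,i,t}$, and end-of-game reimbursements $g_{\mathbf v,i}$. It is run as follows: bidders report their types; in round $t$ each non-eliminated bidder $i$ receives fraction $r_{\mathbf v,i,t}$ and must pay $x_{\mathbf v,i,t}$; a bidder who pays a different amount is eliminated (never allocated to or reimbursed again); at the end each non-eliminated bidder $i$ receives $g_{\mathbf v,i}$. The mechanism is truthful if (limited liability) $x_{\mathbf v,i,t}\le r_{\mathbf v,i,t}v_{i,t}$ for all $\mathbf v,i,t$, and (incentive compatibility) for every $\mathbf v$, bidder $i$, profile $\mathbf v'$ obtained from $\mathbf v$ by replacing bidder $i$'s type, and $\tau\le T$ such that $x_{\mathbf v',i,t}\le r_{\mathbf v',i,t}v_{i,t}$ for all $t\le\tau$, we have $\sum_{t=1}^T (r_{\mathbf v,i,t}v_{i,t}-x_{\mathbf v,i,t})+g_{\mathbf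 v,i}\ \ge\ \sum_{t=1}^{\tau}(r_{\mathbf v',i,t}v_{i,t}-x_{\mathbf v',i,t})+x_{\mathbf v',i,\tau}$. Revenue is ${\sf Rev}(\mathbf v)=\sum_i\sum_t x_{\mathbf v,i,t}-\sum_i g_{\mathbf v,i}$. The "selling the business" benchmark is ${\sf Rev}_{STB}(\mathbf v)=$ the second largest element of $\{|\mathbf v_i|: i\in[k]\}$. A family of mechanisms (one for each $T$) is $\alpha$-competitive against selling the business if there is a constant $C$ (depending only on $k$) such that for all $T$ and all type profiles $\mathbf v$, ${\sf Rev}(\mathbf v)\ge \alpha\,{\sf Rev}_{STB}(\mathbf v)-C$. *)

theory Defs
  imports Complex_Main "HOL-Library.Multiset"
begin

(* Conventions: bidders are 0..<k, rounds are 0..<T (round t here = round t+1 of the paper).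
   A type profile is v :: nat => nat => real, v i t = value of bidder i for the round-t item.
   Profiles are canonical: values outside the index range are 0. *)

type_synonym profile = "nat \<Rightarrow> nat \<Rightarrow> real"

definition valid_profile :: "nat \<Rightarrow> nat \<Rightarrow> profile \<Rightarrow> bool" where
  "valid_profile k T v \<longleftrightarrow>
     (\<forall>i t. (i < k \<and> t < T \<longrightarrow> 0 \<le> v i t \<and> v i t \<le> 1) \<and>
            (\<not> (i < k \<and> t < T) \<longrightarrow> v i t = 0))"

definition total_value :: "nat \<Rightarrow> profile \<Rightarrow> nat \<Rightarrow> real" where
  "total_value T v i = (\<Sum>t<T. v i t)"

(* A direct-revelation mechanism: allocation r, prices x, reimbursements g. *)
definition is_mechanism ::
  "nat \<Rightarrow> nat \<Rightarrow> (profile \<Rightarrow> nat \<Rightarrow> nat \<Rightarrow> real) \<Rightarrow> (profile \<Rightarrow> nat \<Rightarrow> nat \<Rightarrow> real)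
     \<Rightarrow> (profile \<Rightarrow> nat \<Rightarrow> real) \<Rightarrow> bool" where
  "is_mechanism k T r x g \<longleftrightarrow>
     (\<forall>v. valid_profile k T v \<longrightarrow>
        (\<forall>i t. i < k \<and> t < T \<longrightarrow> 0 \<le> r v i t \<and> r v i t \<le> 1) \<and>
        (\<forall>t. t < T \<longrightarrow> (\<Sum>i<k. r v i t) \<le> 1))"

definition limited_liability ::
  "nat \<Rightarrow> nat \<Rightarrow> (profile \<Rightarrow> nat \<Rightarrow> nat \<Rightarrow> real) \<Rightarrow> (profile \<Rightarrow> nat \<Rightarrow> nat \<Rightarrow> real) \<Rightarrow> bool" where
  "limited_liability k T r x \<longleftrightarrow>
     (\<forall>v i t. valid_profile k T v \<and> i < k \<and> t < T \<longrightarrow> x v i t \<le> r v i t * v i t)"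

(* Incentive compatibility; tau is the (0-indexed) round at which the deviating bidder
   stops paying, so the paper's sum over t <= tau (1-indexed) is the sum over t in {0..tau}. *)
definition incentive_compatible ::
  "nat \<Rightarrow> nat \<Rightarrow> (profile \<Rightarrow> nat \<Rightarrow> nat \<Rightarrow> real) \<Rightarrow> (profile \<Rightarrow> nat \<Rightarrow> nat \<Rightarrow> real)
     \<Rightarrow> (profile \<Rightarrow> nat \<Rightarrow> real) \<Rightarrow> bool" where
  "incentive_compatible k T r x g \<longleftrightarrow>
     (\<forall>v v' i \<tau>. valid_profile k T v \<and> valid_profile k T v' \<and> i < k \<and>
        (\<forall>j. j \<noteq> i \<longrightarrow> v' j = v j) \<and> \<tau> < T \<and>
        (\<forall>t\<le>\<tau>. x v' i t \<le> r v' i t * v i t) \<longrightarrow>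
        (\<Sum>t<T. r v i t * v i t - x v i t) + g v i
          \<ge> (\<Sum>t\<le>\<tau>. r v' i t * v i t - x v' i t) + x v' i \<tau>)"

definition truthful ::
  "nat \<Rightarrow> nat \<Rightarrow> (profile \<Rightarrow> nat \<Rightarrow> nat \<Rightarrow> real) \<Rightarrow> (profile \<Rightarrow> nat \<Rightarrow> nat \<Rightarrow> real)
     \<Rightarrow> (profile \<Rightarrow> nat \<Rightarrow> real) \<Rightarrow> bool" where
  "truthful k T r x g \<longleftrightarrow>
     is_mechanism k T r x g \<and> limited_liability k T r x \<and> incentive_compatible k T r x g"

definition revenue ::
  "nat \<Rightarrow> nat \<Rightarrow> (profile \<Rightarrow> nat \<Rightarrow> nat \<Rightarrow> real) \<Rightarrow> (profile \<Rightarrow> nat \<Rightarrow> real) \<Rightarrow> profile \<Rightarrow> real" where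
  "revenue k T x g v = (\<Sum>i<k. \<Sum>t<T. x v i t) - (\<Sum>i<k. g v i)"

definition rev_stb :: "nat \<Rightarrow> nat \<Rightarrow> profile \<Rightarrow> real" where
  "rev_stb k T v = sorted_list_of_multiset (image_mset (total_value T v) (mset [0..<k])) ! (k - 2)"

definition competitive ::
  "nat \<Rightarrow> real \<Rightarrow> (nat \<Rightarrow> profile \<Rightarrow> nat \<Rightarrow> nat \<Rightarrow> real) \<Rightarrow> (nat \<Rightarrow> profile \<Rightarrow> nat \<Rightarrow> real) \<Rightarrow> bool" where
  "competitive k \<alpha> x g \<longleftrightarrow>
     (\<exists>C::real. \<forall>T v. valid_profile k T v \<longrightarrow>
        revenue k T (x T) (g T) v \<ge> \<alpha> * rev_stb k T v - C)"

end

(* Fix the opponent's type, so that the mechanism becomes a single-bidder mechanism, and let a bidder's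
   value per round grow by a large factor B whenever the value accumulated so far passes one of G
   random thresholds, until the total is P. A bidder whose next threshold is i can imitate a bidder
   who keeps the slow rate beyond i: it collects its entire remaining value P - i while the imitated
   bidder hardly advances, paying almost nothing. So the allocation to the slow bidder at
   accumulated value i is at most about U / (P - i), where U is the utility of the fast one.
   Averaging over uniformly random thresholds in [0, S], replacing a threshold by an earlier position
   is a bijection under which each threshold receives the length of the gap following it as its
   weight. The left Riemann sums of 1 / (P - s) are at most ln (P / (P - S)), which is about 1 for
   S = (1 - 1/e) P, so the revenue earned below S is paid back as utility and at most about P / e
   is left. With two such independent bidders the expected revenue is at most about 2 P / e, while both
   bidders have total value at least P. *)
theory Submission
  imports Defs
begin

section \<open>Escalating types and their accumulated values\<close>

text \<open>Values are counted in units of \<open>1 / B ^ G\<close>, so that all accumulated values are natural numbers.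
  An element \<open>c\<close> of \<open>names\<close> lists the thresholds \<open>c 1, \<dots>, c G\<close> and is padded by \<open>c 0 = 0\<close> and
  \<open>c n = S\<close> for \<open>n > G\<close>; different names may describe the same type. The value accumulated before
  round \<open>t\<close> is \<open>orb c t\<close> (not stopped at \<open>P\<close>, which keeps the dynamics monotone).\<close>

locale escalation =
  fixes B G p S :: nat
  assumes B: "2 \<le> B" and p: "1 \<le> p" and S: "3 * S \<le> 2 * (p * B ^ G)"
begin

definition P :: nat where "P = p * B ^ G"

definition names :: "(nat \<Rightarrow> nat) set" where
  "names = {c. mono c \<and> c 0 = 0 \<and> (\<forall>n>G. c n = S)}"

text \<open>Repeated thresholds count with multiplicity, so a block of equal ones raises the rate by
  several factors \<open>B\<close> at once.\<close>

definition lev :: "(nat \<Rightarrow> nat) \<Rightarrow> nat \<Rightarrow> nat" where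
  "lev c z = card {h\<in>{1..G}. c h \<le> z}"

definition orb :: "(nat \<Rightarrow> nat) \<Rightarrow> nat \<Rightarrow> nat" where
  "orb c t = ((\<lambda>z. z + B ^ lev c z) ^^ t) 0"

text \<open>The last positive value may carry the total past \<open>P\<close>, by less than
  \<open>B ^ G\<close>; this overshoot is the term \<open>B ^ G\<close> in the later bounds.\<close>

definition val :: "(nat \<Rightarrow> nat) \<Rightarrow> nat \<Rightarrow> nat" where
  "val c t = (if orb c t < P then B ^ lev c (orb c t) else 0)"

lemma P_pos: "0 < P" using B p by (simp add: P_def)

lemma S_less_P: "S < P" using S P_pos unfolding P_def by linarith

lemma orb_0 [simp]: "orb c 0 = 0" by (simp add: orb_def)

lemma orb_Suc: "orb c (Suc t) = orb c t + B ^ lev c (orb c t)"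
  by (simp add: orb_def)

lemma pow_pos: "0 < B ^ n" using B by simp

lemma strict_mono_orb: "strict_mono (orb c)"
  using pow_pos by (simp add: strict_mono_Suc_iff orb_Suc)

lemma le_orb: "t \<le> orb c t"
  by (rule strict_mono_imp_increasing[OF strict_mono_orb])

definition passage :: "(nat \<Rightarrow> nat) \<Rightarrow> nat \<Rightarrow> nat" where
  "passage c a = (LEAST t. a \<le> orb c t)"

lemma less_passage_iff: "t < passage c a \<longleftrightarrow> orb c t < a"
proof -
  have "a \<le> orb c (passage c a)"
    unfolding passage_def by (rule LeastI[where k=a]) (rule le_orb)
  then show ?thesis
    using not_less_Least[of t "\<lambda>t. a \<le> orb c t"]
      strict_mono_less_eq[OF strict_mono_orb, of c "passage c a" t]
    unfolding passage_def by (meson not_le order_trans)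
qed

lemma passage_le: "passage c a \<le> a"
  unfolding passage_def by (rule Least_le) (rule le_orb)

lemma namesD:
  assumes "c \<in> names"
  shows "mono c" "c 0 = 0" "\<And>n. n > G \<Longrightarrow> c n = S" "c n \<le> S"
proof -
  show *: "mono c" "c 0 = 0" "\<And>n. n > G \<Longrightarrow> c n = S" using assms by (auto simp: names_def)
  show "c n \<le> S" using monoD[OF *(1), of n "max n (Suc G)"] *(3)[of "max n (Suc G)"] by simp
qed

lemma finite_names: "finite names"
proof (rule finite_subset)
  show "names \<subseteq> {c. \<forall>n. (n \<in> {..G} \<longrightarrow> c n \<in> {..S}) \<and> (n \<notin> {..G} \<longrightarrow> c n = S)}"
    using namesD(3,4) by (auto simp: not_le)
  show "finite \<dots>" by (rule finite_set_of_finite_funs) auto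
qed

lemma names_nonempty: "names \<noteq> {}"
proof -
  have "(\<lambda>n. if n > G then S else 0) \<in> names" by (auto simp: names_def mono_def)
  then show ?thesis by blast
qed

lemma lev_mono: "z \<le> z' \<Longrightarrow> lev c z \<le> lev c z'"
  unfolding lev_def by (rule card_mono) auto

lemma lev_le: "lev c z \<le> G"
proof -
  have "card {h\<in>{1..G}. c h \<le> z} \<le> card {1..G}" by (rule card_mono) auto
  then show ?thesis by (simp add: lev_def)
qed

lemma lev_eq:
  assumes "mono c" "g \<le> G" "c g \<le> z" "z < c (Suc g)"
  shows "lev c z = g"
proof -
  have "c h \<le> z \<longleftrightarrow> h \<le> g" for h
  proof
    assume "h \<le> g"
    from monoD[OF assms(1) this] assms(3) show "c h \<le> z" by linarith
  next
    assume "c h \<le> z"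
    with monoD[OF assms(1), of "Suc g" h] assms(4) show "h \<le> g" by linarith
  qed
  then have "{h\<in>{1..G}. c h \<le> z} = {h\<in>{1..G}. h \<le> g}" by presburger
  also have "\<dots> = {1..g}" using assms(2) by auto
  finally show ?thesis by (simp add: lev_def)
qed

lemma pow_lev_le: "B ^ lev c z \<le> B ^ G"
  using power_increasing[OF lev_le, of B c z] B by simp

lemma val_le: "val c t \<le> B ^ G"
  using pow_lev_le by (simp add: val_def)

section \<open>Averages over names when one threshold is moved\<close>

text \<open>The upper limit on \<open>i\<close> lies beyond \<open>c (Suc g)\<close>, so this also
  covers raising the threshold back, the inverse direction in \<open>lower_sum\<close>.\<close>

lemma lower_in_names:
  assumes "c \<in> names" "g < G" "c g \<le> i" "i \<le> c (Suc (Suc g))"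
  shows "c(Suc g := i) \<in> names"
proof -
  note c = namesD[OF assms(1)]
  have "mono (c(Suc g := i))"
  proof (rule mono_iff_le_Suc[THEN iffD2], rule allI)
    fix n show "(c(Suc g := i)) n \<le> (c(Suc g := i)) (Suc n)"
      using assms(3,4) monoD[OF c(1), of n "Suc n"] by auto
  qed
  then show ?thesis using c assms(2) by (auto simp: names_def)
qed

text \<open>Moving the threshold to \<open>i\<close> while remembering its old position
  \<open>j\<close> is reversible. Seen from the new name, \<open>j\<close> is any point after
  threshold \<open>Suc g\<close> up to and including the next one; \<open>f\<close> does not see
  \<open>j\<close>, so only the number of such points remains.\<close>

lemma lower_sum:
  fixes f :: "(nat \<Rightarrow> nat) \<Rightarrow> real"
  assumes "g < G"
  shows "(\<Sum>c\<in>names. \<Sum>i\<in>{c g..<c (Suc g)}. f (c(Suc g := i)))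
       = (\<Sum>c\<in>names. real (c (Suc (Suc g)) - c (Suc g)) * f c)"
proof -
  have "(\<Sum>c\<in>names. \<Sum>i\<in>{c g..<c (Suc g)}. f (c(Suc g := i)))
      = (\<Sum>(c,i)\<in>(SIGMA c:names. {c g..<c (Suc g)}). f (c(Suc g := i)))"
    by (rule sum.Sigma) (auto simp: finite_names)
  also have "\<dots> = (\<Sum>(c,j)\<in>(SIGMA c:names. {c (Suc g)<..c (Suc (Suc g))}). f c)"
  proof (rule sum.reindex_bij_witness[where i = "\<lambda>(c,j). (c(Suc g := j), c (Suc g))"
        and j = "\<lambda>(c,i). (c(Suc g := i), c (Suc g))"])
    fix a assume "a \<in> (SIGMA c:names. {c g..<c (Suc g)})"
    then obtain c i where a: "a = (c,i)" "c \<in> names" "c g \<le> i" "i < c (Suc g)" by auto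
    have "c (Suc g) \<le> c (Suc (Suc g))" using namesD(1)[OF a(2)] by (simp add: monoD)
    then show "(case a of (c,i) \<Rightarrow> (c(Suc g := i), c (Suc g))) \<in> (SIGMA c:names. {c (Suc g)<..c (Suc (Suc g))})"
      using a lower_in_names[OF a(2) assms a(3)] by auto
  next
    fix a assume "a \<in> (SIGMA c:names. {c (Suc g)<..c (Suc (Suc g))})"
    then obtain c j where a: "a = (c,j)" "c \<in> names" "c (Suc g) < j" "j \<le> c (Suc (Suc g))" by auto
    have "c g \<le> c (Suc g)" using namesD(1)[OF a(2)] by (simp add: monoD)
    then show "(case a of (c,j) \<Rightarrow> (c(Suc g := j), c (Suc g))) \<in> (SIGMA c:names. {c g..<c (Suc g)})"
      using a lower_in_names[OF a(2) assms _ a(4)] by auto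
  qed auto
  also have "\<dots> = (\<Sum>c\<in>names. \<Sum>j\<in>{c (Suc g)<..c (Suc (Suc g))}. f c)"
    by (rule sum.Sigma[symmetric]) (auto simp: finite_names)
  finally show ?thesis by simp
qed

text \<open>For constant \<open>f\<close>, \<open>lower_sum\<close> says that consecutive gaps have
  equal sums over all names. There are \<open>Suc G\<close> gaps, and in every name they add up to
  \<open>S\<close>.\<close>

lemma last_gap_sum: "real (Suc G) * (\<Sum>c\<in>names. real (S - c G)) = real (card names) * real S"
proof -
  define N where "N = (\<lambda>g. \<Sum>c\<in>names. real (c (Suc g) - c g))"
  have "N g = N (Suc g)" if "g < G" for g
    using lower_sum[OF that, of "\<lambda>_. 1"] by (simp add: N_def)
  then have eq: "g \<le> G \<Longrightarrow> N g = N 0" for g by (induction g) auto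
  have NG: "N G = (\<Sum>c\<in>names. real (S - c G))"
    unfolding N_def by (intro sum.cong) (auto simp: namesD)
  have "(\<Sum>g<Suc G. N g) = (\<Sum>g<Suc G. N 0)" by (intro sum.cong eq) auto
  then have "real (Suc G) * N G = (\<Sum>g<Suc G. N g)" using eq[of G] by simp
  also have "\<dots> = (\<Sum>c\<in>names. \<Sum>g<Suc G. real (c (Suc g) - c g))"
    unfolding N_def by (rule sum.swap)
  also have "\<dots> = (\<Sum>c\<in>names. real S)"
  proof (rule sum.cong[OF refl])
    fix c assume c: "c \<in> names"
    have "(\<Sum>g<Suc G. real (c (Suc g) - c g)) = (\<Sum>g<Suc G. real (c (Suc g)) - real (c g))"
      using namesD(1)[OF c] by (intro sum.cong) (auto simp: monoD of_nat_diff)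
    also have "\<dots> = real S"
      by (subst sum_lessThan_telescope) (use namesD[OF c] in simp)
    finally show "(\<Sum>g<Suc G. real (c (Suc g) - c g)) = real S" .
  qed
  finally show ?thesis by (simp add: NG)
qed

text \<open>With \<open>x\<close> and \<open>y\<close> the values remaining before and after a gap,
  \<open>ln (y / x) <= y / x - 1\<close> bounds each term by a difference of logarithms. These
  telescope from the first threshold on, where the remaining value is at most
  \<open>P\<close>.\<close>

lemma log_sum:
  assumes "c \<in> names"
  shows "(\<Sum>g<G. real (c (Suc (Suc g)) - c (Suc g)) / (real P - real (c (Suc g))))
     \<le> ln (real P / (real P - real S))"
proof -
  note c = namesD[OF assms]
  have le: "real (c n) < real P" for n using c(4)[of n] S_less_P by simp
  let ?l = "\<lambda>n. - ln (real P - real (c n))"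
  have "(\<Sum>g<G. real (c (Suc (Suc g)) - c (Suc g)) / (real P - real (c (Suc g))))
     \<le> (\<Sum>g<G. ?l (Suc (Suc g)) - ?l (Suc g))"
  proof (rule sum_mono)
    fix g
    let ?x = "real P - real (c (Suc g))" and ?y = "real P - real (c (Suc (Suc g)))"
    have xy: "0 < ?y" "0 < ?x" using le by auto
    have "c (Suc g) \<le> c (Suc (Suc g))" using c(1) by (simp add: monoD)
    then have "real (c (Suc (Suc g)) - c (Suc g)) / ?x = 1 - ?y / ?x"
      using xy by (simp add: of_nat_diff field_simps)
    also have "\<dots> \<le> - ln (?y / ?x)" using ln_le_minus_one[of "?y / ?x"] xy by simp
    also have "\<dots> = ?l (Suc (Suc g)) - ?l (Suc g)" using xy by (simp add: ln_div)
    finally show "real (c (Suc (Suc g)) - c (Suc g)) / ?x \<le> ?l (Suc (Suc g)) - ?l (Suc g)" .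
  qed
  also have "\<dots> = ?l (Suc G) - ?l (Suc 0)"
    by (rule sum_lessThan_telescope[of "\<lambda>n. ?l (Suc n)"])
  also have "\<dots> \<le> ln (real P) - ln (real P - real S)"
    using le[of "Suc 0"] c(3)[of "Suc G"] by simp
  also have "\<dots> = ln (real P / (real P - real S))" using S_less_P by (simp add: ln_div)
  finally show ?thesis .
qed

section \<open>Total values\<close>

text \<open>The increments telescope. The minimum with \<open>orb c n\<close> is carried through the
  induction, and a round that starts below \<open>y\<close> ends at most \<open>B ^ G\<close> above
  it.\<close>

lemma sum_val_between:
  "(\<Sum>t\<in>{t. t < n \<and> x \<le> orb c t \<and> orb c t < y}. B ^ lev c (orb c t)) \<le> min (orb c n) (y + B ^ G) - x"
proof (induction n)
  case (Suc n)
  show ?case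
  proof (cases "x \<le> orb c n \<and> orb c n < y")
    case True
    then have "{t. t < Suc n \<and> x \<le> orb c t \<and> orb c t < y} = insert n {t. t < n \<and> x \<le> orb c t \<and> orb c t < y}"
      by (auto simp: less_Suc_eq)
    moreover have "x \<le> orb c n" "orb c n < y" using True by auto
    ultimately show ?thesis using Suc pow_lev_le[of c "orb c n"] by (simp add: orb_Suc)
  next
    case False
    then have "{t. t < Suc n \<and> x \<le> orb c t \<and> orb c t < y} = {t. t < n \<and> x \<le> orb c t \<and> orb c t < y}"
      by (auto simp: less_Suc_eq)
    then show ?thesis using Suc by (simp add: orb_Suc)
  qed
next
  case 0 show ?case by (simp only: not_less0 simp_thms Collect_empty_eq empty_def[symmetric] sum.empty le0)
qed

text \<open>Every round adds at least one unit, so a game of \<open>P\<close> rounds is long enough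
  for every name to reach \<open>P\<close>.\<close>

lemma le_sum_val: "P \<le> (\<Sum>t<P. val c t)"
proof -
  have "min (orb c n) P \<le> (\<Sum>t<n. val c t)" for n
    by (induction n) (auto simp: val_def orb_Suc)
  from this[of P] show ?thesis using le_orb[of P c] by simp
qed

section \<open>Dynamics of a name with a lowered threshold\<close>

text \<open>The step of \<open>c(Suc g := i)\<close> from position \<open>i\<close> on, by
  \<open>lev_lower_ge\<close>. It is the same for all \<open>i\<close> in gap \<open>g\<close>, so
  all imitators accelerating in the same round can be treated together.\<close>

definition fast :: "(nat \<Rightarrow> nat) \<Rightarrow> nat \<Rightarrow> nat \<Rightarrow> nat" where
  "fast c g z = z + B ^ max (Suc g) (lev c z)"

text \<open>The value in round \<open>u + j\<close> of an imitator of \<open>c\<close> that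
  accelerates in round \<open>u\<close>, cut off at \<open>P\<close> as in
  \<open>val\<close>.\<close>

definition inc :: "(nat \<Rightarrow> nat) \<Rightarrow> nat \<Rightarrow> nat \<Rightarrow> nat \<Rightarrow> nat" where
  "inc c g u j = (let y = (fast c g ^^ j) (orb c u) in if y < P then fast c g y - y else 0)"

lemma fast_mono: "mono (fast c g)"
proof (rule monoI)
  fix z z' :: nat assume z: "z \<le> z'"
  have "B ^ max (Suc g) (lev c z) \<le> B ^ max (Suc g) (lev c z')"
    using B lev_mono[OF z, of c] by (intro power_increasing) auto
  then show "fast c g z \<le> fast c g z'" using z by (simp add: fast_def)
qed

lemma fast_ge: "z + B ^ Suc g \<le> fast c g z"
  unfolding fast_def using B by (intro add_left_mono power_increasing) auto

lemma fast_funpow_ge: "z + j * B ^ Suc g \<le> (fast c g ^^ j) z"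
proof (induction j)
  case (Suc j)
  then show ?case using fast_ge[of "(fast c g ^^ j) z" g c] by simp
qed simp

lemma lev_lower_less:
  assumes "i < c (Suc g)" "z < i"
  shows "lev (c(Suc g := i)) z = lev c z"
proof -
  have "(c(Suc g := i)) h \<le> z \<longleftrightarrow> c h \<le> z" for h using assms by auto
  then show ?thesis unfolding lev_def by presburger
qed

text \<open>Up to the old threshold the lowered name is one level ahead, at \<open>Suc g\<close>;
  from there on both levels agree and are at least \<open>Suc g\<close>.\<close>

lemma lev_lower_ge:
  assumes c: "c \<in> names" and g: "g < G" and i: "c g \<le> i" "i < c (Suc g)" and z: "i \<le> z"
  shows "lev (c(Suc g := i)) z = max (Suc g) (lev c z)"
proof (cases "z < c (Suc g)")
  case True
  have le: "c (Suc g) \<le> c (Suc (Suc g))" using namesD(1)[OF c] by (simp add: monoD)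
  have "c(Suc g := i) \<in> names" using c g i le by (intro lower_in_names) auto
  then have "lev (c(Suc g := i)) z = Suc g"
    using True g z le by (intro lev_eq namesD) auto
  moreover have "lev c z = g" using True g i z by (intro lev_eq namesD[OF c]) auto
  ultimately show ?thesis by simp
next
  case False
  have "(c(Suc g := i)) h \<le> z \<longleftrightarrow> c h \<le> z" for h using False z by auto
  then have "lev (c(Suc g := i)) z = lev c z" unfolding lev_def by presburger
  moreover have "{1..Suc g} \<subseteq> {h\<in>{1..G}. c h \<le> z}"
  proof
    fix h assume "h \<in> {1..Suc g}"
    moreover from this have "c h \<le> c (Suc g)" using namesD(1)[OF c] by (simp add: monoD)
    ultimately show "h \<in> {h\<in>{1..G}. c h \<le> z}" using False g by auto
  qed
  then have "card {1..Suc g} \<le> lev c z" unfolding lev_def by (rule card_mono[rotated]) simp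
  ultimately show ?thesis by simp
qed

lemma orb_less_P: "c \<in> names \<Longrightarrow> orb c t < c n \<Longrightarrow> orb c t < P"
  using namesD(4)[of c n] S_less_P by linarith

text \<open>A position depends only on the levels met in earlier rounds. Before round
  \<open>u\<close> these are met below \<open>i\<close>, so agreement includes round
  \<open>u\<close> itself, whose position may be past \<open>i\<close>.\<close>

lemma orb_lower_before:
  assumes "orb c (u - 1) < i" "i < c (Suc g)" "t \<le> u"
  shows "orb (c(Suc g := i)) t = orb c t"
  using assms(3)
proof (induction t)
  case (Suc t)
  then have "orb c t \<le> orb c (u - 1)"
    using strict_mono_less_eq[OF strict_mono_orb] by simp
  with assms(1) have "lev (c(Suc g := i)) (orb c t) = lev c (orb c t)"
    by (intro lev_lower_less assms(2)) simp
  with Suc show ?case by (simp add: orb_Suc del: fun_upd_apply)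
qed simp

lemma orb_lower_after:
  assumes "c \<in> names" "g < G" "c g \<le> i" "i < c (Suc g)" "orb c (u - 1) < i" "i \<le> orb c u"
  shows "orb (c(Suc g := i)) (u + j) = (fast c g ^^ j) (orb c u)"
proof (induction j)
  case 0
  then show ?case using orb_lower_before[OF assms(5,4), of u] by (simp del: fun_upd_apply)
next
  case (Suc j)
  have "i \<le> orb (c(Suc g := i)) (u + j)"
    using Suc assms(6) fast_funpow_ge[of "orb c u" j g c] by linarith
  from lev_lower_ge[OF assms(1-4) this] show ?case
    using Suc by (simp add: orb_Suc fast_def del: fun_upd_apply)
qed

text \<open>As \<open>j\<close> increases, the values \<open>(fast c g ^^ j) (orb c (t - j))\<close> chain together:
  the interval swept in step \<open>j\<close> ends no earlier than where the next one starts.\<close>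

lemma inc_cover:
  "min P ((fast c g ^^ m) (orb c (t - m))) \<le> orb c t + (\<Sum>j<m. inc c g (t - j) j)"
proof (induction m)
  case (Suc m)
  let ?y = "(fast c g ^^ m) (orb c (t - m))"
  have le: "(fast c g ^^ Suc m) (orb c (t - Suc m)) \<le> fast c g ?y"
  proof -
    have "(fast c g ^^ Suc m) (orb c (t - Suc m)) \<le> (fast c g ^^ Suc m) (orb c (t - m))"
      by (rule monoD[OF mono_pow[OF fast_mono]]) (simp add: strict_mono_less_eq[OF strict_mono_orb])
    then show ?thesis by simp
  qed
  have ge: "?y \<le> fast c g ?y" using fast_ge[of ?y g c] by simp
  have inc: "inc c g (t - m) m = (if ?y < P then fast c g ?y - ?y else 0)"
    by (simp add: inc_def Let_def)
  show ?case
  proof (cases "?y < P")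
    case True
    have "min P ((fast c g ^^ Suc m) (orb c (t - Suc m))) \<le> fast c g ?y" using le by simp
    also have "\<dots> = ?y + inc c g (t - m) m" using True ge inc by simp
    finally show ?thesis using Suc True by simp
  next
    case False
    then show ?thesis using Suc inc by simp
  qed
qed simp

lemma horizon:
  assumes "g < G"
  shows "p * B ^ (G - Suc g) * B ^ Suc g = P"
proof -
  have "B ^ (G - Suc g) * B ^ Suc g = B ^ G" using assms by (simp flip: power_add del: power_Suc)
  then show ?thesis by (simp only: P_def mult.assoc)
qed

lemma sum_shift: "(\<Sum>t\<in>{u..<u + J}. h t) = (\<Sum>j<J. h (u + j))"
  for h :: "nat \<Rightarrow> real"
  using sum.shift_bounds_nat_ivl[of h 0 u J] by (simp add: add.commute atLeast0LessThan)

end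

section \<open>Revenue from a single bidder\<close>

text \<open>What is kept of truthfulness once the opponent is fixed: \<open>r\<close> is the
  allocation and \<open>U\<close> the utility. Prices have disappeared, because limited liability
  bounds the price of the imitated name by its own value for the allocation.\<close>

locale bidder = escalation +
  fixes r :: "(nat \<Rightarrow> nat) \<Rightarrow> nat \<Rightarrow> real" and U :: "(nat \<Rightarrow> nat) \<Rightarrow> real"
  assumes r_nonneg: "c \<in> names \<Longrightarrow> t < P \<Longrightarrow> 0 \<le> r c t"
    and r_le_1: "c \<in> names \<Longrightarrow> t < P \<Longrightarrow> r c t \<le> 1"
    and U_nonneg: "c \<in> names \<Longrightarrow> 0 \<le> U c"
    and deviation: "\<lbrakk>d \<in> names; c \<in> names; D \<le> P; \<And>t. t < D \<Longrightarrow> val c t \<le> val d t\<rbrakk>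
      \<Longrightarrow> (\<Sum>t<D. r c t * (real (val d t) - real (val c t))) \<le> U d"
begin

text \<open>The name \<open>c(Suc g := i)\<close> accelerates in round \<open>u\<close> and imitates \<open>c\<close>; the bound on \<open>u + J\<close>
  ensures that it is exhausted before \<open>c\<close> itself accelerates.\<close>

lemma utility_lower:
  assumes c: "c \<in> names" and g: "g < G" and i: "c g \<le> i" "i < c (Suc g)"
    and iu: "orb c (u - 1) < i" "i \<le> orb c u"
    and te: "\<And>t. t < te \<longleftrightarrow> orb c t < c (Suc g)" and J: "J * B ^ Suc g = P" "u + J \<le> te"
  shows "(1 - 1 / B) * (\<Sum>j<J. r c (u + j) * inc c g u j) \<le> U (c(Suc g := i))"
proof -
  define d where "d = c(Suc g := i)"
  have "c (Suc g) \<le> c (Suc (Suc g))" using namesD(1)[OF c] by (simp add: monoD)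
  then have d: "d \<in> names" unfolding d_def using c g i by (intro lower_in_names) auto
  have before: "orb d t = orb c t" if "t \<le> u" for t
    unfolding d_def by (rule orb_lower_before[OF iu(1) i(2) that])
  have after: "orb d (u + j) = (fast c g ^^ j) (orb c u)" for j
    unfolding d_def by (rule orb_lower_after[OF c g i iu])
  have lev_d: "lev d (orb d t) = max (Suc g) (lev c (orb d t))" if "u \<le> t" for t
  proof -
    have "orb d u \<le> orb d t" using that strict_mono_less_eq[OF strict_mono_orb] by simp
    then have "i \<le> orb d t" using before[of u] iu(2) by simp
    then show ?thesis unfolding d_def by (rule lev_lower_ge[OF c g i])
  qed
  have val_early: "val d t = val c t" if "t < u" for t
  proof -
    have "orb c t \<le> orb c (u - 1)" using that strict_mono_less_eq[OF strict_mono_orb] by simp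
    then have "lev d (orb c t) = lev c (orb c t)"
      unfolding d_def using iu by (intro lev_lower_less i) simp
    then show ?thesis using before[of t] that by (simp add: val_def)
  qed
  have val_c: "val c t = B ^ g" if "u \<le> t" "t < te" for t
  proof -
    have "orb c u \<le> orb c t" using that strict_mono_less_eq[OF strict_mono_orb] by simp
    then have "lev c (orb c t) = g"
      using te[of t] that i iu g by (intro lev_eq namesD[OF c]) auto
    then show ?thesis using orb_less_P[OF c] te[of t] that by (simp add: val_def)
  qed
  have val_d: "B * B ^ g \<le> val d t" if "u \<le> t" "orb d t < P" for t
  proof -
    have "B ^ Suc g \<le> B ^ lev d (orb d t)"
      using B lev_d[OF that(1)] by (intro power_increasing) auto
    then show ?thesis using that by (simp add: val_def)
  qed
  \<comment> \<open>The imitation stops when \<open>d\<close> is exhausted: from then on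
    \<open>val d\<close> is zero, while \<open>val c\<close> may still be positive.\<close>
  define D where "D = passage d P"
  have D: "t < D \<longleftrightarrow> orb d t < P" "D \<le> P" for t
    unfolding D_def by (rule less_passage_iff passage_le)+
  have "\<not> u + J < D"
    using D(1)[of "u + J"] after[of J] fast_funpow_ge[of "orb c u" J g c] J(1) by simp
  then have D_le: "D \<le> u + J" by simp
  have "orb c u < c (Suc g)" 
  proof -
    have "J \<noteq> 0" using J(1) P_pos by (metis mult_0 less_not_refl)
    then show ?thesis using te[of u] J(2) by simp
  qed
  then have uD: "u < D" using D(1)[of u] before[of u] orb_less_P[OF c] by simp
  have DP: "t < P" if "t < D" for t using that D(2) by simp
  have dom: "val c t \<le> val d t" if "t < D" for t
  proof (cases "t < u")
    case False
    then have "u \<le> t" "orb d t < P" "t < te" using that D(1)[of t] D_le J(2) by linarith+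
    then have "B * B ^ g \<le> val d t" "val c t = B ^ g" by - (rule val_d val_c; assumption)+
    moreover have "1 * B ^ g \<le> B * B ^ g" using B by (intro mult_le_mono1) simp
    ultimately show ?thesis by linarith
  qed (simp add: val_early)
  have "(\<Sum>j<J. r c (u + j) * inc c g u j) = (\<Sum>j<J. r c (u + j) * val d (u + j))"
  proof (rule sum.cong[OF refl])
    fix j
    have "inc c g u j = val d (u + j)"
      using after[of j] lev_d[of "u + j"] by (simp add: inc_def val_def fast_def Let_def)
    then show "r c (u + j) * inc c g u j = r c (u + j) * val d (u + j)" by simp
  qed
  also have "\<dots> = (\<Sum>t\<in>{u..<u + J}. r c t * val d t)" by (rule sum_shift[symmetric])
  also have "\<dots> = (\<Sum>t\<in>{u..<D}. r c t * val d t)"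
    using D_le D(1) by (intro sum.mono_neutral_right) (auto simp: val_def)
  finally have "(1 - 1 / B) * (\<Sum>j<J. r c (u + j) * inc c g u j)
      = (\<Sum>t\<in>{u..<D}. r c t * ((1 - 1 / B) * val d t))"
    by (simp add: sum_distrib_left algebra_simps)
  \<comment> \<open>In these rounds \<open>d\<close> is at least one level above \<open>c\<close>,
    so paying like \<open>c\<close> costs at most the fraction \<open>1 / B\<close> of the
    value.\<close>
  also have "\<dots> \<le> (\<Sum>t\<in>{u..<D}. r c t * (real (val d t) - real (val c t)))"
  proof (rule sum_mono)
    fix t assume t: "t \<in> {u..<D}"
    then have "u \<le> t" "orb d t < P" "t < te" using D(1)[of t] D_le J(2) by auto
    then have "B * B ^ g \<le> val d t" "val c t = B ^ g" by - (rule val_d val_c; assumption)+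
    then have "real B * real (val c t) \<le> real (val d t)" by (metis of_nat_le_iff of_nat_mult)
    then have "(1 - 1 / B) * val d t \<le> real (val d t) - real (val c t)"
      using B by (simp add: field_simps)
    then show "r c t * ((1 - 1 / B) * val d t) \<le> r c t * (real (val d t) - real (val c t))"
      using r_nonneg[OF c, of t] DP t by (intro mult_left_mono) auto
  qed
  also have "\<dots> = (\<Sum>t<D. r c t * (real (val d t) - real (val c t)))"
  proof (rule sum.mono_neutral_left)
    show "\<forall>t\<in>{..<D} - {u..<D}. r c t * (real (val d t) - real (val c t)) = 0"
    proof
      fix t assume "t \<in> {..<D} - {u..<D}"
      then have "t < u" by (cases "t < u") auto
      then show "r c t * (real (val d t) - real (val c t)) = 0" by (simp only: val_early) simp
    qed
  qed auto
  also have "\<dots> \<le> U d" by (rule deviation[OF d c D(2) dom])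
  finally show ?thesis by (simp add: d_def)
qed

text \<open>The imitators spread their value unevenly over rounds, but summed over all starting rounds \<open>u\<close>
  they cover every round except the first and last \<open>J\<close> ones with total weight almost one.\<close>

lemma gap_bound:
  assumes c: "c \<in> names" and g: "g < G"
  shows "(\<Sum>t | c g \<le> orb c t \<and> orb c t < c (Suc g). real B ^ g * r c t)
    \<le> 2 * (real P / real B) + (real B + 3) / (real B - 1) * (\<Sum>i\<in>{c g..<c (Suc g)}. U (c(Suc g := i)) / (real P - real i))"
    (is "_ \<le> _ + ?\<kappa> * ?S")
proof -
  let ?f = "\<lambda>i. U (c(Suc g := i)) / (real P - real i)"
  \<comment> \<open>At the accelerated rate \<open>J\<close> rounds exhaust \<open>P\<close>, but at
    the rate \<open>B ^ g\<close> of the gap they are worth only \<open>P / B\<close>. The two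
    uncovered ends of the gap therefore cost \<open>2 * (P / B)\<close>.\<close>
  define J where "J = p * B ^ (G - Suc g)"
  have JP: "J * B ^ Suc g = P" unfolding J_def by (rule horizon[OF g])
  then have JB: "real J * real B ^ g = real P / real B"
    using B by (simp add: field_simps flip: of_nat_power of_nat_mult)
  have mono: "orb c s \<le> orb c t" if "s \<le> t" for s t
    using that strict_mono_less_eq[OF strict_mono_orb] by simp
  have le: "c g \<le> c (Suc g)" "c (Suc g) \<le> c (Suc (Suc g))"
    using namesD(1)[OF c] by (simp_all add: monoD)
  define ta te where "ta = passage c (c g)" and "te = passage c (c (Suc g))"
  have ta: "t < ta \<longleftrightarrow> orb c t < c g" for t unfolding ta_def by (rule less_passage_iff)
  have te: "t < te \<longleftrightarrow> orb c t < c (Suc g)" for t unfolding te_def by (rule less_passage_iff)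
  have T: "{t. c g \<le> orb c t \<and> orb c t < c (Suc g)} = {ta..<te}"
  proof (rule Set.set_eqI)
    fix t
    have "c g \<le> orb c t \<longleftrightarrow> ta \<le> t" using ta[of t] by linarith
    then show "t \<in> {t. c g \<le> orb c t \<and> orb c t < c (Suc g)} \<longleftrightarrow> t \<in> {ta..<te}"
      using te[of t] by simp
  qed
  have less: "c n < P" for n using namesD(4)[OF c, of n] S_less_P by simp
  have orb_P: "orb c t < P" if "t < te" for t using te[of t] that less[of "Suc g"] by simp
  have tP: "t < P" if "t < te" for t using orb_P[OF that] le_orb[of t c] by simp
  have r01: "0 \<le> r c t" "r c t \<le> 1" if "t < te" for t
    using r_nonneg[OF c] r_le_1[OF c] tP that by auto
  have f_nonneg: "0 \<le> ?f i" if "i \<in> {c g..<c (Suc g)}" for i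
  proof -
    have "c(Suc g := i) \<in> names" using that le by (intro lower_in_names c g) auto
    then show ?thesis using U_nonneg that less[of "Suc g"] by simp
  qed
  then have S_nonneg: "0 \<le> ?S" by (rule sum_nonneg)
  have \<kappa>: "0 \<le> ?\<kappa>" using B by simp
  show ?thesis
  proof (cases "ta + 2 * J \<le> te")
    case False
    have "(\<Sum>t\<in>{ta..<te}. real B ^ g * r c t) \<le> (\<Sum>t\<in>{ta..<te}. real B ^ g)"
      using r01 by (intro sum_mono) (simp add: mult_left_le)
    also have "\<dots> \<le> 2 * real J * real B ^ g"
    proof -
      have "real (te - ta) \<le> real (2 * J)" using False by (simp only: of_nat_le_iff)
      from mult_right_mono[OF this, of "real B ^ g"] show ?thesis by simp
    qed
    also have "\<dots> = 2 * (real P / real B)" using JB by simp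
    finally show ?thesis unfolding T using mult_nonneg_nonneg[OF \<kappa> S_nonneg] by simp
  next
    case True
    let ?mid = "{ta + J..<te - J}" and ?us = "{Suc ta..<te - J}"
    \<comment> \<open>The share of round \<open>u + j\<close> in the utility of the imitators
      starting in round \<open>u\<close>. Their thresholds \<open>i\<close> exceed
      \<open>orb c (u - 1)\<close>, so the denominator is an upper bound for
      \<open>P - i\<close>.\<close>
    let ?q = "\<lambda>u j. r c (u + j) * inc c g u j / (real P - real (orb c (u - 1)))"
    have orb_back: "orb c t = orb c (t - j) + j * B ^ g" if "ta + j \<le> t" "t < te" for t j
      using that
    proof (induction j)
      case (Suc j)
      then have "t - Suc j < te" "\<not> t - Suc j < ta" by auto
      then have "lev c (orb c (t - Suc j)) = g"
        using ta[of "t - Suc j"] te[of "t - Suc j"] g by (intro lev_eq namesD[OF c]) auto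
      then show ?case using Suc orb_Suc[of c "t - Suc j"] by (simp add: Suc_diff_Suc)
    qed simp
    \<comment> \<open>By \<open>inc_cover\<close> the numerators add up to at least the remaining
      value \<open>Q\<close>, and all denominators are at most \<open>Q + P / B\<close>. Since
      \<open>P <= 3 * Q\<close>, the ratio is at least \<open>1 / (1 + 3 / B)\<close>.\<close>
    have cover: "real B / (real B + 3) \<le> (\<Sum>j<J. inc c g (t - j) j / (real P - real (orb c (t - j - 1))))"
      if t: "t \<in> ?mid" for t
    proof -
      have tt: "ta + J \<le> t" "t < te" using t by auto
      define Q where "Q = real P - real (orb c t)"
      have "orb c t < S" using te[of t] tt namesD(4)[OF c, of "Suc g"] by simp
      then have Q3: "real P \<le> 3 * Q" "0 < Q"
        using S S_less_P unfolding Q_def P_def[symmetric] by simp_all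
      have QJ: "real P - real (orb c (t - J)) = Q + real P / real B"
        using orb_back[OF tt] JB by (simp add: Q_def)
      have pos: "0 < Q + real P / real B" using Q3 by (simp add: add_pos_nonneg)
      have "P \<le> (fast c g ^^ J) (orb c (t - J))"
        using fast_funpow_ge[of "orb c (t - J)" J g c] JP by simp
      then have "P \<le> orb c t + (\<Sum>j<J. inc c g (t - j) j)"
        using inc_cover[where m=J and t=t and c=c and g=g] by simp
      then have Q_le: "Q \<le> (\<Sum>j<J. real (inc c g (t - j) j))"
        unfolding Q_def by (simp flip: of_nat_sum)
      have "real B / (real B + 3) \<le> Q / (Q + real P / real B)"
        using Q3 B pos by (simp add: field_simps)
      also have "\<dots> \<le> (\<Sum>j<J. real (inc c g (t - j) j)) / (Q + real P / real B)"
        using Q_le pos by (intro divide_right_mono) auto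
      also have "\<dots> = (\<Sum>j<J. inc c g (t - j) j / (real P - real (orb c (t - J))))"
        by (simp add: sum_divide_distrib QJ)
      also have "\<dots> \<le> (\<Sum>j<J. inc c g (t - j) j / (real P - real (orb c (t - j - 1))))"
      proof (rule sum_mono)
        fix j assume "j \<in> {..<J}"
        then have "orb c (t - J) \<le> orb c (t - j - 1)" by (intro mono) auto
        moreover have "orb c (t - j - 1) < P" using tt by (intro orb_P) auto
        ultimately show "inc c g (t - j) j / (real P - real (orb c (t - J)))
          \<le> inc c g (t - j) j / (real P - real (orb c (t - j - 1)))"
          by (intro divide_left_mono) (auto intro: mult_pos_pos)
      qed
      finally show ?thesis .
    qed
    have q_nonneg: "0 \<le> ?q u j" if "u + j < te" for u j
    proof -
      have "orb c (u - 1) < P" using that by (intro orb_P) simp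
      then show ?thesis
        using r01(1)[OF that] by (intro divide_nonneg_nonneg mult_nonneg_nonneg) auto
    qed
    \<comment> \<open>The pairs of a round \<open>t\<close> and a delay \<open>j\<close> are sorted
      by the starting round \<open>u = t - j\<close>. Cutting off \<open>J\<close> rounds at the
      front gives \<open>u > ta\<close>; cutting them off at the end lets every imitation finish
      inside the gap.\<close>
    have mid: "(\<Sum>t\<in>?mid. r c t) \<le> (real B + 3) / real B * (\<Sum>u\<in>?us. \<Sum>j<J. ?q u j)"
    proof -
      have "(\<Sum>t\<in>?mid. r c t * (real B / (real B + 3))) \<le> (\<Sum>t\<in>?mid. \<Sum>j<J. ?q (t - j) j)"
      proof (rule sum_mono)
        fix t assume t: "t \<in> ?mid"
        then have "r c t * (real B / (real B + 3))
            \<le> r c t * (\<Sum>j<J. inc c g (t - j) j / (real P - real (orb c (t - j - 1))))"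
          by (intro mult_left_mono cover r01) auto
        also have "\<dots> = (\<Sum>j<J. ?q (t - j) j)"
          unfolding sum_distrib_left using t by (intro sum.cong) auto
        finally show "r c t * (real B / (real B + 3)) \<le> (\<Sum>j<J. ?q (t - j) j)" .
      qed
      also have "\<dots> = (\<Sum>(t,j)\<in>?mid \<times> {..<J}. ?q (t - j) j)"
        by (rule sum.cartesian_product)
      also have "\<dots> = (\<Sum>(u,j)\<in>(\<lambda>(t,j). (t - j, j)) ` (?mid \<times> {..<J}). ?q u j)"
      proof -
        have "inj_on (\<lambda>(t,j). (t - j, j)) (?mid \<times> {..<J})" by (auto simp: inj_on_def)
        from sum.reindex[OF this, of "\<lambda>(u,j). ?q u j"] show ?thesis
          by (simp only: comp_def case_prod_unfold fst_conv snd_conv)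
      qed
      also have "\<dots> \<le> (\<Sum>(u,j)\<in>?us \<times> {..<J}. ?q u j)"
      proof (rule sum_mono2)
        fix b assume "b \<in> ?us \<times> {..<J} - (\<lambda>(t,j). (t - j, j)) ` (?mid \<times> {..<J})"
        then show "0 \<le> (case b of (u,j) \<Rightarrow> ?q u j)" using q_nonneg by auto
      qed auto
      also have "\<dots> = (\<Sum>u\<in>?us. \<Sum>j<J. ?q u j)" by (simp add: sum.cartesian_product)
      finally have "(\<Sum>t\<in>?mid. r c t) * (real B / (real B + 3)) \<le> (\<Sum>u\<in>?us. \<Sum>j<J. ?q u j)"
        by (simp only: sum_distrib_right)
      from mult_left_mono[OF this, of "(real B + 3) / real B"] show ?thesis using B by simp
    qed
    \<comment> \<open>Exactly \<open>B ^ g\<close> thresholds \<open>i\<close> lead to acceleration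
      in round \<open>u\<close>, which matches the weight \<open>B ^ g\<close> of a slow round. The
      factor \<open>B / (B - 1)\<close> undoes the loss \<open>1 - 1 / B\<close> of
      \<open>utility_lower\<close>.\<close>
    have block: "real B ^ g * (\<Sum>j<J. ?q u j) \<le> real B / (real B - 1) * (\<Sum>i\<in>{orb c (u - 1)<..orb c u}. ?f i)"
      if u: "u \<in> ?us" for u
    proof -
      let ?A = "\<Sum>j<J. r c (u + j) * inc c g u j" and ?w = "real P - real (orb c (u - 1))"
      have w: "0 < ?w" using orb_P[of "u - 1"] u by auto
      have A: "0 \<le> ?A" using r01 u by (intro sum_nonneg) auto
      have au: "c g \<le> orb c (u - 1)" using ta[of "u - 1"] u by auto
      have "orb c u = orb c (u - 1) + B ^ g" using orb_back[of 1 u] u by auto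
      then have card: "card {orb c (u - 1)<..orb c u} = B ^ g" by simp
      have "real B ^ g * ((1 - 1 / real B) * ?A / ?w) = (\<Sum>i\<in>{orb c (u - 1)<..orb c u}. (1 - 1 / real B) * ?A / ?w)"
        by (simp only: sum_constant card of_nat_power)
      also have "\<dots> \<le> (\<Sum>i\<in>{orb c (u - 1)<..orb c u}. ?f i)"
      proof (rule sum_mono)
        fix i assume i: "i \<in> {orb c (u - 1)<..orb c u}"
        have iS: "i < c (Suc g)" using te[of u] i u by auto
        have "(1 - 1 / real B) * ?A / ?w \<le> (1 - 1 / real B) * ?A / (real P - real i)"
          using A B i iS less[of "Suc g"] w
          by (intro divide_left_mono mult_nonneg_nonneg mult_pos_pos) auto
        also have "\<dots> \<le> ?f i"
          using utility_lower[OF c g _ iS _ _ te JP, of u] i au u iS less[of "Suc g"]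
          by (intro divide_right_mono) auto
        finally show "(1 - 1 / real B) * ?A / ?w \<le> ?f i" .
      qed
      finally have "real B ^ g * ((1 - 1 / real B) * ?A / ?w) \<le> (\<Sum>i\<in>{orb c (u - 1)<..orb c u}. ?f i)" .
      then have "real B / (real B - 1) * (real B ^ g * ((1 - 1 / real B) * ?A / ?w))
          \<le> real B / (real B - 1) * (\<Sum>i\<in>{orb c (u - 1)<..orb c u}. ?f i)"
        using B by (intro mult_left_mono) auto
      moreover have "real B / (real B - 1) * (real B ^ g * ((1 - 1 / real B) * ?A / ?w))
          = (real B / (real B - 1) * (1 - 1 / real B)) * (real B ^ g * (?A / ?w))" by simp
      moreover have "real B / (real B - 1) * (1 - 1 / real B) = 1" using B by (simp add: field_simps)
      moreover have "(\<Sum>j<J. ?q u j) = ?A / ?w" by (simp add: sum_divide_distrib)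
      ultimately show ?thesis by (simp only: mult_1)
    qed
    have blocks: "(\<Sum>u\<in>{Suc m..<Suc (m + k)}. \<Sum>i\<in>{orb c (u - 1)<..orb c u}. ?f i)
        = (\<Sum>i\<in>{orb c m<..orb c (m + k)}. ?f i)" for m k
    proof (induction k)
      case (Suc k)
      have "{orb c m<..orb c (m + Suc k)}
          = {orb c m<..orb c (m + k)} \<union> {orb c (m + k)<..orb c (m + Suc k)}"
        using mono[of m "m + k"] mono[of "m + k" "m + Suc k"] by auto
      then show ?case using Suc by (simp add: sum.union_disjoint)
    qed simp
    have "real B ^ g * (\<Sum>u\<in>?us. \<Sum>j<J. ?q u j) 
        \<le> (\<Sum>u\<in>?us. real B / (real B - 1) * (\<Sum>i\<in>{orb c (u - 1)<..orb c u}. ?f i))"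
      by (subst sum_distrib_left) (rule sum_mono, rule block)
    also have "\<dots> = real B / (real B - 1) * (\<Sum>u\<in>?us. \<Sum>i\<in>{orb c (u - 1)<..orb c u}. ?f i)"
      by (simp add: sum_distrib_left)
    also have "\<dots> \<le> real B / (real B - 1) * ?S"
    proof (rule mult_left_mono)
      show "(\<Sum>u\<in>?us. \<Sum>i\<in>{orb c (u - 1)<..orb c u}. ?f i) \<le> ?S"
      proof (cases "Suc ta < te - J")
        case True
        define k where "k = te - J - Suc ta"
        have k: "te - J = Suc (ta + k)" using True by (simp add: k_def)
        have "(\<Sum>u\<in>?us. \<Sum>i\<in>{orb c (u - 1)<..orb c u}. ?f i) = (\<Sum>i\<in>{orb c ta<..orb c (ta + k)}. ?f i)"
          unfolding k by (rule blocks)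
        also have "\<dots> \<le> ?S"
        proof (rule sum_mono2)
          have "c g \<le> orb c ta" using ta[of ta] by simp
          moreover have "orb c (ta + k) < c (Suc g)" using te[of "ta + k"] k by linarith
          ultimately show "{orb c ta<..orb c (ta + k)} \<subseteq> {c g..<c (Suc g)}" by auto
        qed (use f_nonneg in auto)
        finally show ?thesis .
      qed (use S_nonneg in simp)
    qed (use B in simp)
    finally have us: "real B ^ g * (\<Sum>u\<in>?us. \<Sum>j<J. ?q u j) \<le> real B / (real B - 1) * ?S" .
    have split: "{ta..<te} = {ta..<ta + J} \<union> (?mid \<union> {te - J..<te})" using True by auto
    have ends: "(\<Sum>t\<in>{x..<x + J}. real B ^ g * r c t) \<le> real P / real B" if "x + J \<le> te" for x
    proof -
      have "(\<Sum>t\<in>{x..<x + J}. real B ^ g * r c t) \<le> (\<Sum>t\<in>{x..<x + J}. real B ^ g)"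
        using r01 that by (intro sum_mono) (simp add: mult_left_le)
      then show ?thesis using JB by simp
    qed
    have "(\<Sum>t\<in>{ta..<te}. real B ^ g * r c t) = (\<Sum>t\<in>{ta..<ta + J}. real B ^ g * r c t)
        + ((\<Sum>t\<in>?mid. real B ^ g * r c t) + (\<Sum>t\<in>{te - J..<te}. real B ^ g * r c t))"
      unfolding split using True by (subst sum.union_disjoint; (subst sum.union_disjoint)?) auto
    also have "\<dots> \<le> real P / real B + ((\<Sum>t\<in>?mid. real B ^ g * r c t) + real P / real B)"
      using ends[of ta] ends[of "te - J"] True by (intro add_mono) auto
    also have "(\<Sum>t\<in>?mid. real B ^ g * r c t) \<le> (real B + 3) / real B * (real B ^ g * (\<Sum>u\<in>?us. \<Sum>j<J. ?q u j))"
      using mult_left_mono[OF mid, of "real B ^ g"] B by (simp add: sum_distrib_left mult_ac)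
    also have "\<dots> \<le> (real B + 3) / real B * (real B / (real B - 1) * ?S)"
      using B by (intro mult_left_mono us) auto
    also have "\<dots> = ?\<kappa> * ?S" using B by simp
    finally show ?thesis unfolding T by simp
  qed
qed

text \<open>The first \<open>G\<close> gaps are charged to imitators by \<open>gap_bound\<close>.
  After the last threshold there is nobody left to charge, and the whole remaining value, with
  overshoot, is conceded.\<close>

lemma payment_bound:
  assumes c: "c \<in> names"
  shows "(\<Sum>t<P. r c t * val c t) \<le> real G * (2 * (real P / real B))
    + (real B + 3) / (real B - 1) * (\<Sum>g<G. \<Sum>i\<in>{c g..<c (Suc g)}. U (c(Suc g := i)) / (real P - real i))
    + (real P + real B ^ G - real (c G))"
proof -
  let ?h = "\<lambda>t. r c t * val c t"
  have less: "c n < P" for n using namesD(4)[OF c, of n] S_less_P by simp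
  have below: "{t. orb c t < a} = {..<passage c a}" for a by (auto simp: less_passage_iff)
  have levels: "(\<Sum>t | orb c t < c n. ?h t)
      = (\<Sum>g<n. \<Sum>t | c g \<le> orb c t \<and> orb c t < c (Suc g). real B ^ g * r c t)" if "n \<le> G" for n
    using that
  proof (induction n)
    case 0
    then show ?case by (simp add: namesD[OF c])
  next
    case (Suc n)
    let ?T = "{t. c n \<le> orb c t \<and> orb c t < c (Suc n)}"
    have "c n \<le> c (Suc n)" using namesD(1)[OF c] by (simp add: monoD)
    then have eq: "{t. orb c t < c (Suc n)} = {t. orb c t < c n} \<union> ?T" by auto
    have fin: "finite {t. orb c t < c n}" "finite ?T"
      using below[of "c n"] finite_subset[of ?T "{t. orb c t < c (Suc n)}"] below[of "c (Suc n)"] by auto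
    have split: "(\<Sum>t | orb c t < c (Suc n). ?h t) = (\<Sum>t | orb c t < c n. ?h t) + (\<Sum>t\<in>?T. ?h t)"
      unfolding eq by (rule sum.union_disjoint[OF fin]) auto
    have "(\<Sum>t\<in>?T. ?h t) = (\<Sum>t\<in>?T. real B ^ n * r c t)"
    proof (rule sum.cong[OF refl])
      fix t assume t: "t \<in> ?T"
      then have "lev c (orb c t) = n" using Suc.prems by (intro lev_eq namesD[OF c]) auto
      moreover have "orb c t < P" using t by (intro orb_less_P[OF c, of t "Suc n"]) simp
      ultimately show "?h t = real B ^ n * r c t" by (simp add: val_def)
    qed
    then show ?case using Suc split by simp
  qed
  let ?L = "{t. t < P \<and> c G \<le> orb c t \<and> orb c t < P}"
  have "{t. orb c t < c G} \<inter> {..<P} = {t. orb c t < c G}"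
  proof -
    have "t < P" if "orb c t < c G" for t using that le_orb[of t c] less[of G] by linarith
    then show ?thesis by auto
  qed
  then have "(\<Sum>t<P. ?h t) = (\<Sum>t\<in>{t. orb c t < c G} \<union> ?L. ?h t)"
    by (intro sum.mono_neutral_right) (auto simp: val_def)
  also have "\<dots> = (\<Sum>t | orb c t < c G. ?h t) + (\<Sum>t\<in>?L. ?h t)"
    by (rule sum.union_disjoint) (simp_all add: below, auto simp: less_passage_iff)
  finally have split: "(\<Sum>t<P. ?h t) = (\<Sum>t | orb c t < c G. ?h t) + (\<Sum>t\<in>?L. ?h t)" .
  have "(\<Sum>t\<in>?L. ?h t) \<le> (\<Sum>t\<in>?L. real (B ^ lev c (orb c t)))"
    using r_nonneg[OF c] r_le_1[OF c] by (intro sum_mono) (auto simp: val_def mult_left_le_one_le)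
  also have "\<dots> \<le> real P + real B ^ G - real (c G)"
  proof -
    have "(\<Sum>t\<in>?L. B ^ lev c (orb c t)) \<le> P + B ^ G - c G"
      using sum_val_between[where n=P and x="c G" and y=P and c=c] by linarith
    then have "real (\<Sum>t\<in>?L. B ^ lev c (orb c t)) \<le> real (P + B ^ G - c G)" by (simp only: of_nat_le_iff)
    then show ?thesis using less[of G] by (simp add: of_nat_diff)
  qed
  finally have last: "(\<Sum>t\<in>?L. ?h t) \<le> real P + real B ^ G - real (c G)" .
  have "(\<Sum>t | orb c t < c G. ?h t) \<le> (\<Sum>g<G. 2 * (real P / real B)
      + (real B + 3) / (real B - 1) * (\<Sum>i\<in>{c g..<c (Suc g)}. U (c(Suc g := i)) / (real P - real i)))"
    unfolding levels[OF order_refl] by (intro sum_mono gap_bound[OF c]) simp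
  also have "\<dots> = real G * (2 * (real P / real B)) + (real B + 3) / (real B - 1)
      * (\<Sum>g<G. \<Sum>i\<in>{c g..<c (Suc g)}. U (c(Suc g := i)) / (real P - real i))"
    by (simp add: sum.distrib sum_distrib_left)
  finally show ?thesis using split last by linarith
qed

text \<open>The summand is welfare minus utility. On average \<open>lower_sum\<close> turns the
  utilities of the imitators into those of the names themselves, with total weight bounded by
  \<open>log_sum\<close>. The assumption \<open>log\<close> makes this weight at most one, so these
  terms cancel against \<open>U\<close>.\<close>

lemma revenue_bound:
  assumes log: "(real B + 3) / (real B - 1) * ln (real P / (real P - real S)) \<le> 1"
  shows "(\<Sum>c\<in>names. (\<Sum>t<P. r c t * val c t) - U c) \<le> real (card names)
    * (real G * (2 * (real P / real B)) + (real P + real B ^ G - real S) + real S / real (Suc G))"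
proof -
  let ?k = "(real B + 3) / (real B - 1)"
  have k: "0 \<le> ?k" using B by simp
  have "(\<Sum>c\<in>names. \<Sum>g<G. \<Sum>i\<in>{c g..<c (Suc g)}. U (c(Suc g := i)) / (real P - real i))
      = (\<Sum>g<G. \<Sum>c\<in>names. \<Sum>i\<in>{c g..<c (Suc g)}. U (c(Suc g := i)) / (real P - real i))"
    by (rule sum.swap)
  also have "\<dots> = (\<Sum>g<G. \<Sum>c\<in>names. real (c (Suc (Suc g)) - c (Suc g)) * (U c / (real P - real (c (Suc g)))))"
  proof (rule sum.cong[OF refl])
    fix g assume "g \<in> {..<G}"
    then have "g < G" by simp
    from lower_sum[OF this, of "\<lambda>c. U c / (real P - real (c (Suc g)))"]
    show "(\<Sum>c\<in>names. \<Sum>i\<in>{c g..<c (Suc g)}. U (c(Suc g := i)) / (real P - real i))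
      = (\<Sum>c\<in>names. real (c (Suc (Suc g)) - c (Suc g)) * (U c / (real P - real (c (Suc g)))))"
      by (simp only: fun_upd_same)
  qed
  also have "\<dots> = (\<Sum>c\<in>names. \<Sum>g<G. real (c (Suc (Suc g)) - c (Suc g)) * (U c / (real P - real (c (Suc g)))))"
    by (rule sum.swap)
  also have "\<dots> \<le> (\<Sum>c\<in>names. U c * ln (real P / (real P - real S)))"
  proof (rule sum_mono)
    fix c assume c: "c \<in> names"
    have "(\<Sum>g<G. real (c (Suc (Suc g)) - c (Suc g)) * (U c / (real P - real (c (Suc g)))))
        = U c * (\<Sum>g<G. real (c (Suc (Suc g)) - c (Suc g)) / (real P - real (c (Suc g))))"
      by (simp add: sum_distrib_left mult.commute)
    also have "\<dots> \<le> U c * ln (real P / (real P - real S))"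
      by (intro mult_left_mono log_sum U_nonneg c)
    finally show "(\<Sum>g<G. real (c (Suc (Suc g)) - c (Suc g)) * (U c / (real P - real (c (Suc g)))))
      \<le> U c * ln (real P / (real P - real S))" .
  qed
  finally have "?k * (\<Sum>c\<in>names. \<Sum>g<G. \<Sum>i\<in>{c g..<c (Suc g)}. U (c(Suc g := i)) / (real P - real i))
      \<le> ?k * (\<Sum>c\<in>names. U c * ln (real P / (real P - real S)))"
    by (rule mult_left_mono[OF _ k])
  also have "\<dots> = (?k * ln (real P / (real P - real S))) * (\<Sum>c\<in>names. U c)"
    by (subst sum_distrib_right[symmetric]) (simp only: mult_ac)
  also have "\<dots> \<le> 1 * (\<Sum>c\<in>names. U c)"
    by (intro mult_right_mono log sum_nonneg U_nonneg)
  finally have main: "?k * (\<Sum>c\<in>names. \<Sum>g<G. \<Sum>i\<in>{c g..<c (Suc g)}. U (c(Suc g := i)) / (real P - real i))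
      \<le> (\<Sum>c\<in>names. U c)" by simp
  have last: "(\<Sum>c\<in>names. real P + real B ^ G - real (c G))
      = real (card names) * (real P + real B ^ G - real S) + real (card names) * (real S / real (Suc G))"
  proof -
    have "(\<Sum>c\<in>names. real P + real B ^ G - real (c G))
        = (\<Sum>c\<in>names. (real P + real B ^ G - real S) + real (S - c G))"
      using namesD(4) by (intro sum.cong) (auto simp: of_nat_diff)
    also have "\<dots> = real (card names) * (real P + real B ^ G - real S) + (\<Sum>c\<in>names. real (S - c G))"
      by (simp only: sum.distrib sum_constant)
    also have "(\<Sum>c\<in>names. real (S - c G)) = real (card names) * (real S / real (Suc G))"
      using last_gap_sum by (simp add: field_simps)
    finally show ?thesis .
  qed
  have "(\<Sum>c\<in>names. (\<Sum>t<P. r c t * val c t) - U c) \<le> (\<Sum>c\<in>names. real G * (2 * (real P / real B))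
    + ?k * (\<Sum>g<G. \<Sum>i\<in>{c g..<c (Suc g)}. U (c(Suc g := i)) / (real P - real i))
    + (real P + real B ^ G - real (c G)) - U c)"
    by (intro sum_mono diff_right_mono payment_bound)
  also have "\<dots> = real (card names) * (real G * (2 * (real P / real B)))
    + ?k * (\<Sum>c\<in>names. \<Sum>g<G. \<Sum>i\<in>{c g..<c (Suc g)}. U (c(Suc g := i)) / (real P - real i))
    + (\<Sum>c\<in>names. real P + real B ^ G - real (c G)) - (\<Sum>c\<in>names. U c)"
    by (simp only: sum.distrib sum_subtractf sum_constant sum_distrib_left)
  finally show ?thesis using main last unfolding distrib_left by linarith
qed

end

section \<open>Truthful mechanisms as single-bidder instances\<close>

definition utility ::
  "nat \<Rightarrow> (profile \<Rightarrow> nat \<Rightarrow> nat \<Rightarrow> real) \<Rightarrow> (profile \<Rightarrow> nat \<Rightarrow> nat \<Rightarrow> real)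
     \<Rightarrow> (profile \<Rightarrow> nat \<Rightarrow> real) \<Rightarrow> profile \<Rightarrow> nat \<Rightarrow> real" where
  "utility T r x g v i = (\<Sum>t<T. r v i t * v i t - x v i t) + g v i"

text \<open>Prices for \<open>v'\<close> are at most \<open>r * v'\<close>, hence affordable under
  \<open>v\<close>, and paying them leaves at least the value differences. Payment stops in round
  \<open>D - 1\<close>, where the full value is kept.\<close>

lemma truthful_deviation:
  assumes tr: "truthful k T r x g" and v: "valid_profile k T v" and v': "valid_profile k T v'"
    and i: "i < k" and others: "\<forall>j. j \<noteq> i \<longrightarrow> v' j = v j"
    and D: "D \<le> T" "\<And>t. t < D \<Longrightarrow> v' i t \<le> v i t" and T: "0 < T"
  shows "(\<Sum>t<D. r v' i t * (v i t - v' i t)) \<le> utility T r x g v i"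
proof -
  have r: "0 \<le> r w i t" if "valid_profile k T w" "t < T" for w t
    using tr i that unfolding truthful_def is_mechanism_def by blast
  have x: "x w i t \<le> r w i t * w i t" if "valid_profile k T w" "t < T" for w t
    using tr i that unfolding truthful_def limited_liability_def by blast
  have ic: "(\<Sum>t\<le>\<tau>. r w i t * v i t - x w i t) + x w i \<tau> \<le> utility T r x g v i"
    if "valid_profile k T w" "\<forall>j. j \<noteq> i \<longrightarrow> w j = v j" "\<tau> < T"
      "\<And>t. t \<le> \<tau> \<Longrightarrow> x w i t \<le> r w i t * v i t" for w \<tau>
    using tr v i that unfolding truthful_def incentive_compatible_def utility_def by blast
  have key: "(\<Sum>t\<le>\<tau>. r w i t * (v i t - w i t)) \<le> utility T r x g v i"
    if w: "valid_profile k T w" "\<forall>j. j \<noteq> i \<longrightarrow> w j = v j" "\<tau> < T" "\<And>t. t \<le> \<tau> \<Longrightarrow> w i t \<le> v i t" for w \<tau>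
  proof -
    have le: "r w i t * w i t \<le> r w i t * v i t" if "t \<le> \<tau>" for t
      using r[OF w(1), of t] w(3,4) that by (intro mult_left_mono) auto
    have wi: "0 \<le> w i t" if "t < T" for t using w(1) i that unfolding valid_profile_def by blast
    have "(\<Sum>t\<le>\<tau>. r w i t * (v i t - w i t))
        = (\<Sum>t<\<tau>. r w i t * (v i t - w i t)) + r w i \<tau> * (v i \<tau> - w i \<tau>)"
      by (simp flip: lessThan_Suc_atMost)
    also have "\<dots> \<le> (\<Sum>t<\<tau>. r w i t * v i t - x w i t) + r w i \<tau> * v i \<tau>"
    proof (rule add_mono)
      show "(\<Sum>t<\<tau>. r w i t * (v i t - w i t)) \<le> (\<Sum>t<\<tau>. r w i t * v i t - x w i t)"
      proof (rule sum_mono)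
        fix t assume "t \<in> {..<\<tau>}"
        then show "r w i t * (v i t - w i t) \<le> r w i t * v i t - x w i t"
          using x[OF w(1), of t] w(3) by (simp add: right_diff_distrib)
      qed
      show "r w i \<tau> * (v i \<tau> - w i \<tau>) \<le> r w i \<tau> * v i \<tau>"
        using r[OF w(1,3)] wi[OF w(3)] by (intro mult_left_mono) auto
    qed
    also have "\<dots> = (\<Sum>t\<le>\<tau>. r w i t * v i t - x w i t) + x w i \<tau>"
      by (simp flip: lessThan_Suc_atMost)
    also have "\<dots> \<le> utility T r x g v i"
    proof (rule ic[OF w(1-3)])
      fix t assume t: "t \<le> \<tau>"
      then show "x w i t \<le> r w i t * v i t" using x[OF w(1), of t] le[OF t] w(3) by linarith
    qed
    finally show ?thesis .
  qed
  show ?thesis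
  proof (cases D)
    \<comment> \<open>There is no round to stop in; imitating oneself gives the required
      nonnegativity of the utility.\<close>
    case 0
    then show ?thesis using key[OF v, of "T - 1"] T by simp
  next
    case (Suc \<tau>)
    have "(\<Sum>t\<le>\<tau>. r v' i t * (v i t - v' i t)) \<le> utility T r x g v i"
      by (rule key[OF v' others]) (use D Suc in auto)
    then show ?thesis by (simp only: Suc lessThan_Suc_atMost)
  qed
qed

lemma revenue_eq_utility:
  "revenue k T x g v = (\<Sum>i<k. (\<Sum>t<T. r v i t * v i t) - utility T r x g v i)"
  by (simp add: revenue_def utility_def sum_subtractf sum.distrib)

lemma rev_stb_2: "rev_stb 2 T v = min (total_value T v 0) (total_value T v 1)"
proof -
  have "mset [0..<2] = {#0, 1::nat#}" by (simp add: upt_rec numeral_2_eq_2)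
  then show ?thesis by (simp add: rev_stb_def min_def insort_key.simps add.commute)
qed

context escalation
begin

text \<open>Dividing by the largest rate \<open>B ^ G\<close> puts the values into the unit interval
  and turns the total \<open>P\<close> into \<open>p\<close>.\<close>

definition prof :: "(nat \<Rightarrow> nat) \<Rightarrow> (nat \<Rightarrow> nat) \<Rightarrow> profile" where
  "prof c d i t = (if i < 2 \<and> t < P then val (if i = 0 then c else d) t / real B ^ G else 0)"

lemma scale_pos: "0 < real B ^ G" using B by simp

lemma valid_prof: "valid_profile 2 P (prof c d)"
proof -
  have "real (val e t) \<le> real B ^ G" for e t
    using val_le[of e t] by (simp flip: of_nat_power)
  then show ?thesis using scale_pos by (simp add: valid_profile_def prof_def)
qed

lemma prof_simps:
  assumes "t < P"
  shows "prof c d 0 t = val c t / real B ^ G" "prof c d (Suc 0) t = val d t / real B ^ G"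
  using assms by (simp_all add: prof_def)

lemma total_value_prof:
  assumes "i < 2"
  shows "real p \<le> total_value P (prof c d) i"
proof -
  let ?e = "if i = 0 then c else d"
  have "total_value P (prof c d) i = real (\<Sum>t<P. val ?e t) / real B ^ G"
    using assms by (simp add: total_value_def prof_def sum_divide_distrib)
  also have "\<dots> \<ge> real P / real B ^ G"
    using le_sum_val[of ?e] scale_pos by (intro divide_right_mono) (simp_all only: of_nat_le_iff less_imp_le)
  also have "real P / real B ^ G = p" using scale_pos by (simp add: P_def)
  finally show ?thesis .
qed

text \<open>For each fixed name of the opponent, either bidder is an instance of
  \<open>bidder\<close>, with utilities rescaled by \<open>B ^ G\<close>. Revenue splits into the
  two resulting differences of welfare and utility.\<close>

lemma average_revenue:
  assumes tr: "truthful 2 P r x g"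
    and log: "(real B + 3) / (real B - 1) * ln (real P / (real P - real S)) \<le> 1"
  shows "real B ^ G * (\<Sum>c\<in>names. \<Sum>d\<in>names. revenue 2 P x g (prof c d)) \<le> 2 * real (card names) ^ 2
    * (real G * (2 * (real P / real B)) + (real P + real B ^ G - real S) + real S / real (Suc G))"
proof -
  let ?K = "real B ^ G" and ?N = "real (card names)"
  let ?bd = "real G * (2 * (real P / real B)) + (real P + real B ^ G - real S) + real S / real (Suc G)"
  let ?u = "utility P r x g"
  have r01: "0 \<le> r v i t" "r v i t \<le> 1" if "valid_profile 2 P v" "i < 2" "t < P" for v i t
    using tr that unfolding truthful_def is_mechanism_def by blast+
  have dev: "(\<Sum>t<D. r v' i t * (v i t - v' i t)) \<le> ?u v i"
    if "valid_profile 2 P v" "valid_profile 2 P v'" "i < 2" "\<forall>j. j \<noteq> i \<longrightarrow> v' j = v j"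
      "D \<le> P" "\<And>t. t < D \<Longrightarrow> v' i t \<le> v i t" for v v' i D
    by (rule truthful_deviation[OF tr that P_pos])
  have scaled: "(\<Sum>t<D. r v' i t * (real (val e t) - real (val e' t))) = ?K * (\<Sum>t<D. r v' i t * (v i t - v' i t))"
    if "D \<le> P" "\<And>t. t < P \<Longrightarrow> v i t = val e t / ?K" "\<And>t. t < P \<Longrightarrow> v' i t = val e' t / ?K" for v v' i D e e'
    unfolding sum_distrib_left using that scale_pos
    by (intro sum.cong) (auto simp: diff_divide_distrib[symmetric])
  have first: "bidder B G p S (\<lambda>c. r (prof c d) 0) (\<lambda>c. ?K * ?u (prof c d) 0)" for d
  proof unfold_locales
    fix e c D assume D: "D \<le> P" "\<And>t. t < D \<Longrightarrow> val c t \<le> val e t"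
    have "(\<Sum>t<D. r (prof c d) 0 t * (prof e d 0 t - prof c d 0 t)) \<le> ?u (prof e d) 0"
      using D scale_pos by (intro dev valid_prof) (auto simp: prof_def divide_right_mono fun_eq_iff)
    then show "(\<Sum>t<D. r (prof c d) 0 t * (real (val e t) - real (val c t))) \<le> ?K * ?u (prof e d) 0"
      using scaled[where v="prof e d" and v'="prof c d" and i=0 and e=e and e'=c, OF D(1)] scale_pos
      by (simp add: prof_simps)
  next
    fix c show "0 \<le> ?K * ?u (prof c d) 0"
      using dev[of "prof c d" "prof c d" 0 0] valid_prof scale_pos by simp
  qed (use r01 valid_prof in auto)
  have second: "bidder B G p S (\<lambda>d. r (prof c d) (Suc 0)) (\<lambda>d. ?K * ?u (prof c d) (Suc 0))" for c
  proof unfold_locales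
    fix e d D assume D: "D \<le> P" "\<And>t. t < D \<Longrightarrow> val d t \<le> val e t"
    have "(\<Sum>t<D. r (prof c d) (Suc 0) t * (prof c e (Suc 0) t - prof c d (Suc 0) t)) \<le> ?u (prof c e) (Suc 0)"
      using D scale_pos
      by (intro dev valid_prof) (auto simp: prof_def divide_right_mono fun_eq_iff less_2_cases_iff)
    then show "(\<Sum>t<D. r (prof c d) (Suc 0) t * (real (val e t) - real (val d t))) \<le> ?K * ?u (prof c e) (Suc 0)"
      using scaled[where v="prof c e" and v'="prof c d" and i="Suc 0" and e=e and e'=d, OF D(1)] scale_pos
      by (simp add: prof_simps)
  next
    fix d show "0 \<le> ?K * ?u (prof c d) (Suc 0)"
      using dev[of "prof c d" "prof c d" "Suc 0" 0] valid_prof scale_pos by simp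
  qed (use r01 valid_prof in auto)
  have split: "?K * revenue 2 P x g (prof c d) =
      ((\<Sum>t<P. r (prof c d) 0 t * val c t) - ?K * ?u (prof c d) 0)
    + ((\<Sum>t<P. r (prof c d) (Suc 0) t * val d t) - ?K * ?u (prof c d) (Suc 0))" for c d
  proof -
    have "?K * (\<Sum>t<P. r (prof c d) 0 t * prof c d 0 t) = (\<Sum>t<P. r (prof c d) 0 t * val c t)"
      "?K * (\<Sum>t<P. r (prof c d) (Suc 0) t * prof c d (Suc 0) t) = (\<Sum>t<P. r (prof c d) (Suc 0) t * val d t)"
      unfolding sum_distrib_left using scale_pos by (auto intro!: sum.cong simp: prof_simps)
    then show ?thesis
      by (simp add: revenue_eq_utility[where r=r] numeral_2_eq_2 distrib_left right_diff_distrib)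
  qed
  have "?K * (\<Sum>c\<in>names. \<Sum>d\<in>names. revenue 2 P x g (prof c d))
      = (\<Sum>c\<in>names. \<Sum>d\<in>names. (\<Sum>t<P. r (prof c d) 0 t * val c t) - ?K * ?u (prof c d) 0)
      + (\<Sum>c\<in>names. \<Sum>d\<in>names. (\<Sum>t<P. r (prof c d) (Suc 0) t * val d t) - ?K * ?u (prof c d) (Suc 0))"
    by (simp only: sum_distrib_left split sum.distrib)
  also have "\<dots> \<le> (\<Sum>d\<in>names. ?N * ?bd) + (\<Sum>c\<in>names. ?N * ?bd)"
  proof (rule add_mono)
    show "(\<Sum>c\<in>names. \<Sum>d\<in>names. (\<Sum>t<P. r (prof c d) 0 t * val c t) - ?K * ?u (prof c d) 0)
      \<le> (\<Sum>d\<in>names. ?N * ?bd)"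
      by (subst sum.swap) (rule sum_mono, rule bidder.revenue_bound[OF first log])
    show "(\<Sum>c\<in>names. \<Sum>d\<in>names. (\<Sum>t<P. r (prof c d) (Suc 0) t * val d t) - ?K * ?u (prof c d) (Suc 0))
      \<le> (\<Sum>c\<in>names. ?N * ?bd)"
      by (rule sum_mono) (rule bidder.revenue_bound[OF second log])
  qed
  finally have "?K * (\<Sum>c\<in>names. \<Sum>d\<in>names. revenue 2 P x g (prof c d)) \<le> 2 * (?N * (?N * ?bd))"
    by (simp only: sum_constant mult_2)
  then show ?thesis by (simp only: power2_eq_square mult.assoc)
qed

text \<open>The benchmark is at least \<open>p\<close> on every \<open>prof c d\<close>. After
  division by \<open>2 * P\<close>, the overshoot contributes \<open>1 / p\<close>, the ends of the
  gaps \<open>2 * G / B\<close>, the value beyond \<open>S\<close> the main term, and the average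
  last gap at most \<open>1 / Suc G\<close>.\<close>

lemma competitive_le:
  assumes tr: "truthful 2 P r x g" and "0 \<le> \<alpha>"
    and comp: "\<And>v. valid_profile 2 P v \<Longrightarrow> \<alpha> * rev_stb 2 P v - C \<le> revenue 2 P x g v"
    and log: "(real B + 3) / (real B - 1) * ln (real P / (real P - real S)) \<le> 1"
  shows "\<alpha> / 2 \<le> (C / 2 + 1) / p + 2 * G / B + (1 - S / P) + 1 / Suc G"
proof -
  let ?K = "real B ^ G" and ?N = "real (card names)"
  let ?bd = "real G * (2 * (real P / real B)) + (real P + real B ^ G - real S) + real S / real (Suc G)"
  have N: "0 < ?N" using finite_names names_nonempty by (simp add: card_gt_0_iff)
  have PK: "real P = real p * ?K" by (simp add: P_def)
  have "?N * (?N * (\<alpha> * p - C)) = (\<Sum>c\<in>names. \<Sum>d\<in>names. \<alpha> * p - C)" by simp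
  also have "\<dots> \<le> (\<Sum>c\<in>names. \<Sum>d\<in>names. revenue 2 P x g (prof c d))"
  proof (intro sum_mono)
    fix c d
    have "real p \<le> rev_stb 2 P (prof c d)" by (simp add: rev_stb_2 total_value_prof)
    then have "\<alpha> * p \<le> \<alpha> * rev_stb 2 P (prof c d)" using \<open>0 \<le> \<alpha>\<close> by (rule mult_left_mono)
    then show "\<alpha> * p - C \<le> revenue 2 P x g (prof c d)" using comp[OF valid_prof, of c d] by linarith
  qed
  finally have "?K * (?N * (?N * (\<alpha> * p - C))) \<le> ?K * (\<Sum>c\<in>names. \<Sum>d\<in>names. revenue 2 P x g (prof c d))"
    using scale_pos by (intro mult_left_mono) auto
  also have "\<dots> \<le> 2 * ?N ^ 2 * ?bd" by (rule average_revenue[OF tr log])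
  finally have "?N ^ 2 * (?K * (\<alpha> * p - C)) \<le> ?N ^ 2 * (2 * ?bd)"
    by (simp only: power2_eq_square mult_ac)
  then have "?K * (\<alpha> * p - C) \<le> 2 * ?bd" using N by simp
  then have "?K * (\<alpha> * p - C) / (2 * real P) \<le> 2 * ?bd / (2 * real P)"
    using P_pos by (intro divide_right_mono) auto
  moreover have "?K * (\<alpha> * p - C) / (2 * real P) = \<alpha> / 2 - C / 2 / p"
    using p B by (simp add: PK field_simps)
  moreover have "2 * ?bd / (2 * real P) = 2 * G / B + (1 + 1 / p - S / P) + S / P / Suc G"
  proof -
    have "?K / real P = 1 / p" using B by (simp add: PK)
    moreover have "2 * ?bd / (2 * real P) = ?bd / real P"
      by (rule mult_divide_mult_cancel_left) simp
    ultimately show ?thesis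
      using P_pos by (simp add: add_divide_distrib diff_divide_distrib)
  qed
  moreover have "S / P / Suc G \<le> 1 / Suc G"
    using S_less_P by (intro divide_right_mono) auto
  ultimately have "\<alpha> / 2 - C / 2 / p \<le> 2 * G / B + (1 + 1 / p - S / P) + 1 / Suc G" by linarith
  moreover have "(C / 2 + 1) / p = C / 2 / p + 1 / p" by (rule add_divide_distrib)
  ultimately show ?thesis by linarith
qed

end

section \<open>Choice of the parameters\<close>

theorem theorem10:
  fixes \<alpha> :: real
  assumes "\<alpha> > 2 / exp 1"
  shows "\<not> (\<exists>r x g. (\<forall>T. truthful 2 T (r T) (x T) (g T)) \<and> competitive 2 \<alpha> x g)"
proof
  assume "\<exists>r x g. (\<forall>T. truthful 2 T (r T) (x T) (g T)) \<and> competitive 2 \<alpha> x g"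
  then obtain r x g C where tr: "\<And>T. truthful 2 T (r T) (x T) (g T)"
    and comp: "\<And>T v. valid_profile 2 T v \<Longrightarrow> \<alpha> * rev_stb 2 T v - C \<le> revenue 2 T (x T) (g T) v"
    unfolding competitive_def by blast
  have e3: "1 / 3 \<le> 1 / exp (1::real)" "1 / exp (1::real) < 1"
    using exp_le exp_gt_one[of "1::real"] by (auto simp: field_simps)
  \<comment> \<open>\<open>S\<close> will be about \<open>(1 - \<beta>) * P\<close>. Taking
    \<open>\<beta>\<close> above \<open>1 / e\<close> makes \<open>L < 1\<close>, which leaves room
    for the factor \<open>(B + 3) / (B - 1)\<close>; and \<open>1 / e >= 1 / 3\<close> gives
    \<open>3 * S <= 2 * P\<close>.\<close>
  obtain \<beta> where \<beta>: "1 / exp 1 < \<beta>" "\<beta> < min (\<alpha> / 2) 1"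
    using dense[of "1 / exp 1" "min (\<alpha> / 2) 1"] assms e3 by auto
  then have \<beta>3: "1 / 3 < \<beta>" "\<beta> < 1" "\<beta> < \<alpha> / 2"
    using order.strict_trans1[OF e3(1) \<beta>(1)] by simp_all
  define \<epsilon> L where "\<epsilon> = \<alpha> / 2 - \<beta>" and "L = ln (1 / \<beta>)"
  have \<epsilon>: "0 < \<epsilon>" using \<beta>3 by (simp add: \<epsilon>_def)
  have "1 / \<beta> < exp 1" using \<beta> \<beta>3 by (simp add: field_simps)
  then have "L < ln (exp 1)" unfolding L_def using \<beta>3 by (subst ln_less_cancel_iff) auto
  then have L: "L < 1" by simp
  \<comment> \<open>\<open>G\<close> comes first, since \<open>B\<close> has to be large compared
    with \<open>G\<close>. The choices keep each of three error terms below
    \<open>\<epsilon> / 4\<close>, and \<open>B > 4 / (1 - L)\<close> gives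
    \<open>(B + 3) * L <= B - 1\<close>.\<close>
  obtain G :: nat where G: "4 / \<epsilon> < real G" using reals_Archimedean2 by blast
  obtain B :: nat where B_large: "max (max 2 (4 / (1 - L))) (8 * real G / \<epsilon>) < real B" using reals_Archimedean2 by blast
  obtain p :: nat where p_large: "max 1 (4 * (\<bar>C\<bar> / 2 + 2) / \<epsilon>) < real p" using reals_Archimedean2 by blast
  define Q where "Q = p * B ^ G"
  \<comment> \<open>Rounding down loses at most one unit out of \<open>P\<close>, which is absorbed
    by a second term \<open>1 / p\<close>.\<close>
  define S where "S = nat \<lfloor>(1 - \<beta>) * Q\<rfloor>"
  have pos: "2 < real B" "1 < real p" using B_large p_large by auto
  have pQ: "real p \<le> real Q" 
  proof -
    have "1 \<le> real B ^ G" using pos by (intro one_le_power) simp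
    then show ?thesis using mult_left_mono[of 1 "real B ^ G" "real p"] by (simp add: Q_def)
  qed
  have Q: "0 < real Q" using pQ pos by linarith
  have "0 \<le> (1 - \<beta>) * Q" using \<beta>3 by simp
  then have S_floor: "real S \<le> (1 - \<beta>) * Q" "(1 - \<beta>) * Q - 1 \<le> real S" unfolding S_def by linarith+
  have "3 * real S \<le> 2 * real Q"
  proof -
    have "(1 - \<beta>) * Q \<le> 2 / 3 * Q" using \<beta>3 by (intro mult_right_mono) auto
    then show ?thesis using S_floor by simp
  qed
  then have "3 * S \<le> 2 * Q" by linarith
  then interpret escalation B G p S using pos by unfold_locales (auto simp: Q_def)
  have P_eq: "P = Q" by (simp add: P_def Q_def)
  have k: "(real B + 3) / (real B - 1) * L \<le> 1"
  proof -
    have "4 < real B * (1 - L)" using B_large L by (simp add: field_simps)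
    then have "(real B + 3) * L \<le> real B - 1" using L by (simp add: algebra_simps)
    then show ?thesis using pos by (simp add: field_simps)
  qed
  have "\<beta> * Q \<le> real Q - real S" using S_floor by (simp add: algebra_simps)
  moreover have \<beta>Q: "0 < \<beta> * Q" using \<beta>3 Q by simp
  ultimately have "0 < real Q - real S" by linarith
  with \<open>\<beta> * Q \<le> real Q - real S\<close> have "real Q / (real Q - real S) \<le> 1 / \<beta>" "0 < real Q / (real Q - real S)"
    using Q \<beta>3 by (simp_all add: field_simps)
  then have "ln (real Q / (real Q - real S)) \<le> L" unfolding L_def using \<beta>3 by (subst ln_le_cancel_iff) auto
  then have "(real B + 3) / (real B - 1) * ln (real Q / (real Q - real S)) \<le> (real B + 3) / (real B - 1) * L"
    using pos by (intro mult_left_mono) auto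
  with k have log: "(real B + 3) / (real B - 1) * ln (real Q / (real Q - real S)) \<le> 1" by linarith
  have "0 \<le> \<alpha>" using \<beta>3 by linarith
  have "\<alpha> / 2 \<le> (C / 2 + 1) / p + 2 * G / B + (1 - S / Q) + 1 / Suc G"
    using competitive_le[OF tr \<open>0 \<le> \<alpha>\<close> comp] log unfolding P_eq by blast
  moreover have "1 - S / Q \<le> \<beta> + 1 / p"
  proof -
    have "(1 - \<beta>) - 1 / Q \<le> S / Q" using divide_right_mono[OF S_floor(2), of "real Q"] Q by (simp add: diff_divide_distrib)
    moreover have "1 / real Q \<le> 1 / p" using pQ pos by (intro divide_left_mono) auto
    ultimately show ?thesis by linarith
  qed
  moreover have "(C / 2 + 1) / p + 1 / p < \<epsilon> / 4"
  proof -
    have "(C / 2 + 1) / p + 1 / p \<le> (\<bar>C\<bar> / 2 + 2) / p"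
      unfolding add_divide_distrib[symmetric] using pos by (intro divide_right_mono) auto
    also have "\<dots> < \<epsilon> / 4" using p_large \<epsilon> by (simp add: field_simps)
    finally show ?thesis .
  qed
  moreover have "2 * G / B < \<epsilon> / 4" using B_large \<epsilon> pos by (simp add: field_simps)
  moreover have "1 / Suc G < \<epsilon> / 4" using G \<epsilon> by (simp add: field_simps)
  ultimately show False using \<epsilon> \<epsilon>_def by linarith
qed

end
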